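(* There exist a compact convex domain $\Omega\subset\mathbb{R}^2$, a finite positive measure $f^+$ on $\Omega$ that has a density in $L^\infty(\Omega)$ with respect to Lebesgue measure, and a positive measure $f^-$ with the same total mass as $f^+$, concentrated on $\partial\Omega$ and having a bounded density with respect to $\mathcal{H}^{1}$ restricted to $\partial\Omega$ (i.e. $f^-\le C\,\mathcal{H}^{1}|_{\partial\Omega}$ for some constant $C$), such that the transport density $\sigma$ between $f^+$ and $f^-$ does not belong to $L^\infty(\Omega)$.
   Context: Transport density: for finite positive compactly supported Borel measures $\mu,\nu$ on $\mathbb{R}^d$ of equal mass with $\mu$ absolutely continuous, let $\Pi(\mu,\nu)$ be the set of positive measures on $\mathbb{R}^d\times\mathbb{R}^d$ with marginals $\mu,\nu$, and let $\gamma$ be any minimizer of $\int |x-y|\,d\gamma$ over $\Pi(\mu,\nu)$. The transport density from $\mu$ to $\nu$ is the measure $$\sigma(A)=\int \mathcal{H}^1(A\cap[x,y])\,d\gamma(x,y)\quad\text{for every Borel set }A,$$ where $[x,y]$ is the segment from $x$ to $y$ and $\mathcal{H}^1$ is the one-dimensional Hausdorff measure. It is known that $\sigma$ does not depend on the choice of the optimal $\gamma$ and that it is absolutely continuous with respect to Lebesgue measure. Absolutely continuous measures are identified with their densities. *)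

theory Defs
  imports "HOL-Probability.Probability"
begin

(* The bound on the sets is needed because diameter is unspecified on unbounded sets.
   No normalising constant appears: omega_1 / 2 = 1 in dimension one. *)
definition hausdorff1_delta :: "real \<Rightarrow> 'a::metric_space set \<Rightarrow> ennreal" where
  "hausdorff1_delta \<delta> S =
    (INF A\<in>{A :: nat \<Rightarrow> 'a set. S \<subseteq> (\<Union>i. A i) \<and> (\<forall>i. bounded (A i) \<and> diameter (A i) \<le> \<delta>)}.
       \<Sum>i. ennreal (diameter (A i)))"

definition hausdorff1 :: "'a::metric_space set \<Rightarrow> ennreal" where
  "hausdorff1 S = (SUP \<delta>\<in>{0<..}. hausdorff1_delta \<delta> S)"

definition transport_plans ::
    "'a::euclidean_space measure \<Rightarrow> 'a measure \<Rightarrow> ('a \<times> 'a) measure set" where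
  "transport_plans \<mu> \<nu> =
    {\<gamma>. sets \<gamma> = sets borel \<and> distr \<gamma> borel fst = \<mu> \<and> distr \<gamma> borel snd = \<nu>}"

definition transport_cost :: "('a::euclidean_space \<times> 'a) measure \<Rightarrow> ennreal" where
  "transport_cost \<gamma> = (\<integral>\<^sup>+ (x, y). ennreal (norm (x - y)) \<partial>\<gamma>)"

definition optimal_plans ::
    "'a::euclidean_space measure \<Rightarrow> 'a measure \<Rightarrow> ('a \<times> 'a) measure set" where
  "optimal_plans \<mu> \<nu> =
    {\<gamma> \<in> transport_plans \<mu> \<nu>. \<forall>\<gamma>' \<in> transport_plans \<mu> \<nu>. transport_cost \<gamma> \<le> transport_cost \<gamma>'}"

definition transport_density :: "('a::euclidean_space \<times> 'a) measure \<Rightarrow> 'a measure" where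
  "transport_density \<gamma> =
    measure_of UNIV (sets borel) (\<lambda>A. \<integral>\<^sup>+ (x, y). hausdorff1 (A \<inter> closed_segment x y) \<partial>\<gamma>)"

(* A measure belongs to L-infinity(Om) if its restriction to Om has an essentially bounded
   density with respect to Lebesgue measure; Om is meant to be a Borel set. *)
definition in_Linfty_on :: "'a::euclidean_space measure \<Rightarrow> 'a set \<Rightarrow> bool" where
  "in_Linfty_on \<mu> \<Omega> \<longleftrightarrow>
    (\<exists>\<rho> \<in> borel_measurable (restrict_space lborel \<Omega>).
       restrict_space \<mu> \<Omega> = density (restrict_space lborel \<Omega>) \<rho> \<and>
       esssup (restrict_space lborel \<Omega>) \<rho> < \<infinity>)"

end

theory Submission
  imports Defs
begin

text \<open>
  Let \<open>f\<^sub>p\<close> be Lebesgue measure on the square \<open>[1, 2] \<times> [0, 1]\<close>, contained in the rectangle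
  \<open>\<Omega> = [-1, 2] \<times> [0, 1]\<close>, and transport it to the bottom side of \<open>\<Omega>\<close> along the straight lines
  \<open>y = - s (x - s)\<close>, where \<open>s\<close> in \<open>[-1, 0]\<close> is the abscissa of the point at which the line meets
  the bottom side. The lines with parameters \<open>s\<close> and \<open>s'\<close> meet at \<open>(s + s', - s s')\<close>, which is
  never above the bottom side: they can be the rays of an optimal transport. For \<open>x\<close> in
  \<open>[1, 2]\<close> the ordinate \<open>y\<close> moves at a speed between 1 and 4 as \<open>s\<close> varies, so the image \<open>f\<^sub>m\<close> of \<open>f\<^sub>p\<close> has a bounded density on the side. But the rays become tangent to the
  boundary as \<open>s\<close> tends to 0: near the origin, the mass carried by the rays with \<open>- e \<le> s \<le> 0\<close>,
  which is at least \<open>e\<close>, is squeezed into the height \<open>2 e\<^sup>2\<close>. The rectangle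
  \<open>[0, e] \<times> [0, 2 e\<^sup>2]\<close> has area \<open>2 e\<^sup>3\<close> and each of these rays has a length at least \<open>e\<close> in it,
  so that the transport density gives it a mass of at least \<open>e\<^sup>2\<close>; the ratio of mass to area is at
  least \<open>1 / (2 e)\<close>, which is unbounded.

  Optimality rests on the dual potential \<open>arsinh s\<close> on the bottom side. The line with parameter
  \<open>s\<close> makes an angle of cosine \<open>1 / sqrt (s\<^sup>2 + 1) = arsinh' s\<close> with the side, which is the
  first-order condition for \<open>s\<close> to minimise the distance to \<open>(s, 0)\<close> plus \<open>arsinh s\<close>; lemma
  \<open>potential_less\<close> shows that the minimum is strict. Complementary slackness (lemma
  \<open>map_plan_unique_optimal\<close>) then says that the transport along these lines is optimal and that
  every optimal plan is carried by its graph, so that one computation covers all optimal plans.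

  The Hausdorff measure enters through two facts. On a segment it is the image of Lebesgue
  measure (lemma \<open>hausdorff1_inter_closed_segment\<close>), which makes the set function that defines the
  transport density countably additive and computable. And the mass distribution principle turns
  a bound on bounded closed sets by the diameter into a bound by the Hausdorff measure; it gives
  both the lower bound on segments and the bounded density of \<open>f\<^sub>m\<close>.
\<close>

section \<open>One-dimensional Hausdorff measure on segments\<close>

text \<open>
  Covers indexed by sets of intervals come without an enumeration, and may be finite; the indices
  left over are filled with the empty set, which has diameter 0.
\<close>

lemma hausdorff1_delta_le_countable:
  assumes I: "countable I" and cov: "S \<subseteq> (\<Union>i\<in>I. F i)" and "0 \<le> \<delta>"
    and F: "\<And>i. i \<in> I \<Longrightarrow> bounded (F i) \<and> diameter (F i) \<le> \<delta>"
  shows "hausdorff1_delta \<delta> S \<le> (\<integral>\<^sup>+ i. ennreal (diameter (F i)) \<partial>count_space I)"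
proof -
  define e where "e = to_nat_on I"
  define A where "A n = (if n \<in> e ` I then F (from_nat_into I n) else {})" for n
  have eI: "from_nat_into I (e i) = i" if "i \<in> I" for i
    using that I by (simp add: e_def)
  have "inj_on e I" using I inj_on_to_nat_on by (auto simp: e_def)
  then have bij: "bij_betw e I (e ` I)" by (simp add: inj_on_imp_bij_betw)
  have "S \<subseteq> (\<Union>n. A n)"
  proof
    fix x assume "x \<in> S"
    with cov obtain i where "i \<in> I" "x \<in> F i" by auto
    then have "x \<in> A (e i)" by (simp add: A_def eI)
    then show "x \<in> (\<Union>n. A n)" by blast
  qed
  moreover have "bounded (A n) \<and> diameter (A n) \<le> \<delta>" for n
    using F \<open>0 \<le> \<delta>\<close> by (auto simp: A_def eI)
  ultimately have "hausdorff1_delta \<delta> S \<le> (\<Sum>n. ennreal (diameter (A n)))"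
    unfolding hausdorff1_delta_def by (intro INF_lower) auto
  also have "\<dots> = (\<integral>\<^sup>+ n. ennreal (diameter (A n)) \<partial>count_space UNIV)"
    by (simp add: nn_integral_count_space_nat)
  also have "\<dots> = (\<integral>\<^sup>+ n. ennreal (diameter (A n)) \<partial>count_space (e ` I))"
    by (rule nn_integral_count_space_eq) (auto simp: A_def)
  also have "\<dots> = (\<integral>\<^sup>+ i. ennreal (diameter (A (e i))) \<partial>count_space I)"
    by (rule nn_integral_bij_count_space[OF bij, symmetric])
  also have "\<dots> = (\<integral>\<^sup>+ i. ennreal (diameter (F i)) \<partial>count_space I)"
    by (rule nn_integral_cong) (simp add: A_def eI)
  finally show ?thesis .
qed

lemma dist_linepath: "dist (linepath x y s) (linepath x y t) = \<bar>s - t\<bar> * dist x y"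
proof -
  have "linepath x y s - linepath x y t = (t - s) *\<^sub>R (x - y)"
    by (simp add: linepath_def algebra_simps)
  then show ?thesis by (simp add: dist_norm abs_minus_commute)
qed

text \<open>
  Outer regularity puts \<open>B\<close> inside an open set of nearly the same measure, and the covering lemma
  covers \<open>B\<close> by non-overlapping intervals inside that set, as short as desired. Their images have diameter at
  most the length times \<open>dist x y\<close>, so the covering sum is at most the measure of the open set
  times \<open>dist x y\<close>, whatever the mesh.
\<close>

lemma hausdorff1_linepath_le:
  fixes x y :: "'a::euclidean_space"
  assumes B[measurable]: "B \<in> sets borel" and B01: "B \<subseteq> {0..1}"
  shows "hausdorff1 (linepath x y ` B) \<le> ennreal (dist x y) * emeasure lborel B"
  unfolding hausdorff1_def
proof (rule SUP_least)
  fix \<delta> :: real assume "\<delta> \<in> {0<..}"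
  then have \<delta>: "\<delta> > 0" by simp
  define L where "L = dist x y"
  have L: "L \<ge> 0" by (simp add: L_def)
  show "hausdorff1_delta \<delta> (linepath x y ` B) \<le> ennreal (dist x y) * emeasure lborel B"
  proof (rule ennreal_le_epsilon)
    fix e :: real assume e: "0 < e"
    \<comment> \<open>the term \<open>+ 1\<close> covers the degenerate segment \<open>x = y\<close>\<close>
    define e' where "e' = e / (L + 1)"
    have e': "e' > 0" "L * e' \<le> e" using e L by (auto simp: e'_def field_simps)
    obtain U where U: "open U" "B \<subseteq> U" "emeasure lborel (U - B) < e'"
      using outer_regular_lborel[OF B e'(1)] by blast
    define r where "r = \<delta> / (2 * (L + 1))"
    have r: "r > 0" "L * (2 * r) \<le> \<delta>" using \<delta> L by (auto simp: r_def field_simps)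
    define g where "g t = (if t \<in> U then ball t r \<inter> U else ball t 1)" for t
    have "gauge g" using U(1) r by (auto simp: gauge_def g_def)
    moreover have "B \<subseteq> cbox 0 1" "box (0::real) 1 \<noteq> {}" using B01 by auto
    ultimately obtain D where D: "countable D" 
       "\<And>K. K \<in> D \<Longrightarrow> interior K \<noteq> {} \<and> (\<exists>c d. K = cbox c d)"
       "pairwise (\<lambda>A B. interior A \<inter> interior B = {}) D"
       "\<And>K. K \<in> D \<Longrightarrow> \<exists>x \<in> B \<inter> K. K \<subseteq> g x" "B \<subseteq> \<Union>D"
      using covering_lemma[of B 0 1 g] by metis
    have KU: "K \<subseteq> U \<and> (\<exists>t. K \<subseteq> ball t r)" if "K \<in> D" for K
      using D(4)[OF that] U(2) by (auto simp: g_def split: if_splits)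
    have diam: "diameter (linepath x y ` K) \<le> L * (d - c)" if "K = cbox c d" "c \<le> d" for K c d
    proof (rule diameter_le)
      show "linepath x y ` K \<noteq> {} \<or> 0 \<le> L * (d - c)" using that L by auto
    next
      fix u v assume "u \<in> linepath x y ` K" "v \<in> linepath x y ` K"
      then obtain s t where st: "s \<in> K" "t \<in> K" "u = linepath x y s" "v = linepath x y t" by auto
      then have "norm (u - v) = \<bar>s - t\<bar> * L"
        using dist_linepath[of x y s t] by (simp add: dist_norm L_def)
      also have "\<dots> \<le> (d - c) * L" using st that L by (intro mult_right_mono) auto
      finally show "norm (u - v) \<le> L * (d - c)" by (simp add: mult.commute)
    qed
    have K: "diameter (linepath x y ` K) \<le> \<delta>" 
      "ennreal (diameter (linepath x y ` K)) \<le> ennreal L * emeasure lborel (interior K)"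
      "bounded (linepath x y ` K)"
      if "K \<in> D" for K
    proof -
      obtain c d where cd: "K = cbox c d" "interior K \<noteq> {}" using D(2)[OF \<open>K \<in> D\<close>] by auto
      then have lt: "c < d" by (auto simp: interior_cbox box_real)
      obtain t where "K \<subseteq> ball t r" using KU[OF \<open>K \<in> D\<close>] by auto
      moreover have "c \<in> K" "d \<in> K" using cd(1) lt by auto
      ultimately have "c \<in> ball t r" "d \<in> ball t r" by blast+
      then have "d - c \<le> 2 * r" by (auto simp: dist_real_def)
      then have "L * (d - c) \<le> L * (2 * r)" using L by (rule mult_left_mono)
      then show "diameter (linepath x y ` K) \<le> \<delta>" using diam[OF cd(1)] lt r by auto
      have "ennreal (diameter (linepath x y ` K)) \<le> ennreal (L * (d - c))"
        using diam[OF cd(1)] lt by (intro ennreal_leI) auto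
      also have "\<dots> = ennreal L * emeasure lborel (interior K)"
        using cd(1) lt L by (simp add: ennreal_mult)
      finally show "ennreal (diameter (linepath x y ` K)) \<le> ennreal L * emeasure lborel (interior K)" .
      have "compact (linepath x y ` K)" unfolding cd(1)
        by (intro compact_continuous_image continuous_on_linepath) simp
      then show "bounded (linepath x y ` K)" by (rule compact_imp_bounded)
    qed
    have "hausdorff1_delta \<delta> (linepath x y ` B) \<le>
        (\<integral>\<^sup>+ K. ennreal (diameter (linepath x y ` K)) \<partial>count_space D)"
    proof (rule hausdorff1_delta_le_countable)
      show "linepath x y ` B \<subseteq> (\<Union>K\<in>D. linepath x y ` K)" using D(5) by blast
    qed (use D(1) \<delta> K in auto)
    also have "\<dots> \<le> (\<integral>\<^sup>+ K. ennreal L * emeasure lborel (interior K) \<partial>count_space D)"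
      using K by (intro nn_integral_mono) simp
    also have "\<dots> = ennreal L * (\<integral>\<^sup>+ K. emeasure lborel (interior K) \<partial>count_space D)"
      by (simp add: nn_integral_cmult)
    also have "(\<integral>\<^sup>+ K. emeasure lborel (interior K) \<partial>count_space D) = emeasure lborel (\<Union>K\<in>D. interior K)"
      using D(1,3) by (intro emeasure_UN_countable[symmetric])
        (auto simp: disjoint_family_on_def pairwise_def)
    also have "\<dots> \<le> emeasure lborel U"
      using KU U(1) interior_subset by (intro emeasure_mono) fastforce+
    also have "emeasure lborel U = emeasure lborel B + emeasure lborel (U - B)"
      using U by (subst plus_emeasure) (auto simp: Un_absorb1 )
    also have "ennreal L * (emeasure lborel B + emeasure lborel (U - B)) \<le>
        ennreal L * (emeasure lborel B + ennreal e')"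
      using U(3) by (intro mult_left_mono add_left_mono) auto
    also have "\<dots> = ennreal L * emeasure lborel B + ennreal (L * e')"
      using L e' by (simp add: distrib_left ennreal_mult)
    also have "\<dots> \<le> ennreal L * emeasure lborel B + ennreal e"
      using e' by (intro add_left_mono ennreal_leI) auto
    finally show "hausdorff1_delta \<delta> (linepath x y ` B) \<le> ennreal (dist x y) * emeasure lborel B + ennreal e"
      by (simp add: L_def mult_left_mono)
  qed
qed

text \<open>
  Members of a cover can be replaced by their closures, which are measurable and have the same
  diameter; subadditivity does the rest.
\<close>

lemma mass_distribution_principle:
  assumes sets: "sets \<mu> = sets borel"
    and le: "\<And>B. closed B \<Longrightarrow> bounded B \<Longrightarrow> c * emeasure \<mu> B \<le> ennreal (diameter B)"
  shows "c * emeasure \<mu> A \<le> hausdorff1 A"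
proof -
  have "c * emeasure \<mu> A \<le> hausdorff1_delta 1 A"
    unfolding hausdorff1_delta_def
  proof (rule INF_greatest)
    fix F :: "nat \<Rightarrow> 'a set"
    assume "F \<in> {F. A \<subseteq> (\<Union>i. F i) \<and> (\<forall>i. bounded (F i) \<and> diameter (F i) \<le> 1)}"
    then have F: "A \<subseteq> (\<Union>i. F i)" "\<And>i. bounded (F i)" by auto
    have "A \<subseteq> (\<Union>i. closure (F i))" 
    proof
      fix x assume "x \<in> A"
      then obtain i where "x \<in> F i" using F(1) by blast
      then have "x \<in> closure (F i)" using closure_subset[of "F i"] by blast
      then show "x \<in> (\<Union>i. closure (F i))" by blast
    qed
    moreover have cl: "closure (F i) \<in> sets \<mu>" for i by (simp add: sets)
    ultimately have "emeasure \<mu> A \<le> emeasure \<mu> (\<Union>i. closure (F i))"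
      by (intro emeasure_mono sets.countable_UN) auto
    also have "\<dots> \<le> (\<Sum>i. emeasure \<mu> (closure (F i)))"
      using cl by (intro emeasure_subadditive_countably image_subsetI)
    finally have "c * emeasure \<mu> A \<le> (\<Sum>i. c * emeasure \<mu> (closure (F i)))"
      by (simp add: mult_left_mono)
    also have "\<dots> \<le> (\<Sum>i. ennreal (diameter (F i)))"
    proof (rule suminf_le)
      fix i
      have "c * emeasure \<mu> (closure (F i)) \<le> ennreal (diameter (closure (F i)))"
        using F(2) by (intro le) auto
      then show "c * emeasure \<mu> (closure (F i)) \<le> ennreal (diameter (F i))"
        using F(2) by (simp add: diameter_closure)
    qed auto
    finally show "c * emeasure \<mu> A \<le> (\<Sum>i. ennreal (diameter (F i)))" .
  qed
  also have "\<dots> \<le> hausdorff1 A" unfolding hausdorff1_def by (rule SUP_upper) simp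
  finally show ?thesis .
qed

lemma emeasure_lborel_le_diameter:
  fixes P :: "real set"
  assumes d: "0 \<le> d" and le: "\<And>s t. s \<in> P \<Longrightarrow> t \<in> P \<Longrightarrow> \<bar>s - t\<bar> \<le> d"
  shows "emeasure lborel P \<le> ennreal d"
proof (cases "P = {}")
  case False
  then obtain p where p: "p \<in> P" by blast
  have bdd: "bdd_below P" using le[OF p] by (intro bdd_belowI[of _ "p - d"]) (smt (verit))
  have "P \<subseteq> {Inf P .. Inf P + d}"
  proof
    fix t assume t: "t \<in> P"
    have "t - d \<le> Inf P" using False le[OF t] by (intro cInf_greatest) (smt (verit))+
    then show "t \<in> {Inf P .. Inf P + d}" using cInf_lower[OF t bdd] by auto
  qed
  then have "emeasure lborel P \<le> emeasure lborel {Inf P .. Inf P + d}"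
    by (intro emeasure_mono) auto
  also have "\<dots> = ennreal d" using d by simp
  finally show ?thesis .
qed simp

lemma linepath_borel_measurable [measurable]: "linepath x y \<in> borel_measurable borel"
  for x y :: "'a::euclidean_space"
  by (intro borel_measurable_continuous_onI continuous_on_linepath)

definition segment_measure :: "'a::euclidean_space \<Rightarrow> 'a \<Rightarrow> 'a measure" where
  "segment_measure x y =
     scale_measure (ennreal (dist x y)) (distr (restrict_space lborel {0..1}) borel (linepath x y))"

lemma sets_segment_measure [simp, measurable_cong]: "sets (segment_measure x y) = sets borel"
  by (simp add: segment_measure_def)

lemma emeasure_segment_measure:
  assumes [measurable]: "A \<in> sets borel"
  shows "emeasure (segment_measure x y) A =
    ennreal (dist x y) * emeasure lborel {t\<in>{0..1}. linepath x y t \<in> A}"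
proof -
  have [measurable]: "linepath x y \<in> restrict_space lborel {0..1} \<rightarrow>\<^sub>M borel"
    by (intro measurable_restrict_space1) simp
  have "linepath x y -` A \<inter> {0..1} = {t\<in>{0..1}. linepath x y t \<in> A}" by auto
  moreover have "{t\<in>{0..1}. linepath x y t \<in> A} \<in> sets borel" by measurable
  ultimately show ?thesis
    by (simp add: segment_measure_def emeasure_distr emeasure_restrict_space space_restrict_space
        del: atLeastAtMost_iff)
qed

text \<open>
  For the lower bound, a set of diameter \<open>d\<close> meets the segment in parameters that differ by at most
  \<open>d / dist x y\<close>, so the mass distribution principle applies with constant 1.
\<close>

lemma hausdorff1_inter_closed_segment:
  fixes x y :: "'a::euclidean_space"
  assumes A[measurable]: "A \<in> sets borel"
  shows "hausdorff1 (A \<inter> closed_segment x y) = emeasure (segment_measure x y) A"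
proof (rule antisym)
  have [measurable]: "{t\<in>{0..1}. linepath x y t \<in> A} \<in> sets borel" by measurable
  have im: "A \<inter> closed_segment x y = linepath x y ` {t\<in>{0..1}. linepath x y t \<in> A}"
    by (auto simp: linepath_image_01[symmetric])
  show "hausdorff1 (A \<inter> closed_segment x y) \<le> emeasure (segment_measure x y) A"
    unfolding im emeasure_segment_measure[OF A] by (rule hausdorff1_linepath_le) auto
  have "1 * emeasure (segment_measure x y) (A \<inter> closed_segment x y) \<le> hausdorff1 (A \<inter> closed_segment x y)"
  proof (rule mass_distribution_principle)
    fix B :: "'a set" assume B: "closed B" "bounded B"
    let ?P = "{t\<in>{0..1}. linepath x y t \<in> B}"
    have "ennreal (dist x y) * emeasure lborel ?P \<le> ennreal (diameter B)"
    proof (cases "x = y")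
      case False
      then have L: "dist x y > 0" by simp
      have dB: "0 \<le> diameter B" using B(2) by (rule diameter_ge_0)
      have "emeasure lborel ?P \<le> ennreal (diameter B / dist x y)"
      proof (rule emeasure_lborel_le_diameter)
        fix s t assume "s \<in> ?P" "t \<in> ?P"
        then have "dist (linepath x y s) (linepath x y t) \<le> diameter B"
          using B(2) by (intro diameter_bounded_bound) auto
        then show "\<bar>s - t\<bar> \<le> diameter B / dist x y" using L by (simp add: dist_linepath field_simps)
      qed (use dB in simp)
      then have "ennreal (dist x y) * emeasure lborel ?P \<le> ennreal (dist x y) * ennreal (diameter B / dist x y)"
        by (rule mult_left_mono) simp
      also have "\<dots> = ennreal (diameter B)" using L dB by (simp add: ennreal_mult[symmetric])
      finally show ?thesis .
    qed simp
    then show "1 * emeasure (segment_measure x y) B \<le> ennreal (diameter B)"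
      using B(1) by (simp add: emeasure_segment_measure)
  qed simp
  moreover have "{t\<in>{0..1}. linepath x y t \<in> A \<inter> closed_segment x y} = {t\<in>{0..1}. linepath x y t \<in> A}"
    by (auto simp: linepath_image_01[symmetric])
  ultimately show "emeasure (segment_measure x y) A \<le> hausdorff1 (A \<inter> closed_segment x y)"
    by (simp add: emeasure_segment_measure)
qed

section \<open>Transport density and optimal plans\<close>

lemma measurable_emeasure_segment_measure [measurable]:
  fixes A :: "'a::euclidean_space set"
  assumes [measurable]: "A \<in> sets borel"
  shows "(\<lambda>z. emeasure (segment_measure (fst z) (snd z)) A) \<in> borel_measurable borel"
proof -
  have [measurable]: "(fst :: 'a \<times> 'a \<Rightarrow> 'a) \<in> borel_measurable borel" "(snd :: 'a \<times> 'a \<Rightarrow> 'a) \<in> borel_measurable borel"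
    by (intro borel_measurable_continuous_onI continuous_intros)+
  have [measurable]: "(\<lambda>(z :: 'a \<times> 'a, t). linepath (fst z) (snd z) t) \<in> borel_measurable (borel \<Otimes>\<^sub>M lborel)"
    unfolding linepath_def by measurable
  have "(\<lambda>z :: 'a \<times> 'a. \<integral>\<^sup>+ t. indicator {0..1} t * indicator A (linepath (fst z) (snd z) t) \<partial>lborel)
      \<in> borel_measurable borel"
    by measurable
  also have "(\<lambda>z :: 'a \<times> 'a. \<integral>\<^sup>+ t. indicator {0..1} t * indicator A (linepath (fst z) (snd z) t) \<partial>lborel) =
      (\<lambda>z. emeasure lborel {t\<in>{0..1}. linepath (fst z) (snd z) t \<in> A})" (is "?l = ?r")
  proof
    fix z :: "'a \<times> 'a"
    have m: "{t\<in>{0..1}. linepath (fst z) (snd z) t \<in> A} \<in> sets lborel" by measurable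
    have "?l z = (\<integral>\<^sup>+ t. indicator {t\<in>{0..1}. linepath (fst z) (snd z) t \<in> A} t \<partial>lborel)"
      by (intro nn_integral_cong) (auto split: split_indicator)
    also have "\<dots> = ?r z" using m by (rule nn_integral_indicator)
    finally show "?l z = ?r z" .
  qed
  finally show ?thesis
    by (simp add: emeasure_segment_measure)
qed

text \<open>
  \<open>measure_of\<close> yields the zero measure unless it is given a countably additive function. Here
  additivity comes from the segment measures by monotone convergence, for which the integrand has
  to be measurable in the end points.
\<close>

lemma emeasure_transport_density:
  fixes \<gamma> :: "('a::euclidean_space \<times> 'a) measure"
  assumes \<gamma>[measurable_cong]: "sets \<gamma> = sets borel" and A: "A \<in> sets borel"
  shows "emeasure (transport_density \<gamma>) A =
    (\<integral>\<^sup>+ z. emeasure (segment_measure (fst z) (snd z)) A \<partial>\<gamma>)"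
proof -
  let ?\<sigma> = "\<lambda>A. \<integral>\<^sup>+ (x, y). hausdorff1 (A \<inter> closed_segment x y) \<partial>\<gamma>"
  have eq: "?\<sigma> B = (\<integral>\<^sup>+ z. emeasure (segment_measure (fst z) (snd z)) B \<partial>\<gamma>)"
    if "B \<in> sets borel" for B
    using that by (intro nn_integral_cong) (simp add: hausdorff1_inter_closed_segment split: prod.split)
  have "countably_additive (sets borel) ?\<sigma>"
    unfolding countably_additive_def
  proof safe
    fix B :: "nat \<Rightarrow> 'a set"
    assume B: "range B \<subseteq> sets borel" "disjoint_family B"
    then have [measurable]: "B i \<in> sets borel" for i by auto
    have "(\<Sum>i. ?\<sigma> (B i)) = (\<Sum>i. \<integral>\<^sup>+ z. emeasure (segment_measure (fst z) (snd z)) (B i) \<partial>\<gamma>)"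
      by (simp add: eq)
    also have "\<dots> = (\<integral>\<^sup>+ z. (\<Sum>i. emeasure (segment_measure (fst z) (snd z)) (B i)) \<partial>\<gamma>)"
      by (rule nn_integral_suminf[symmetric]) measurable
    also have "\<dots> = (\<integral>\<^sup>+ z. emeasure (segment_measure (fst z) (snd z)) (\<Union>i. B i) \<partial>\<gamma>)"
      using B by (intro nn_integral_cong suminf_emeasure) auto
    also have "\<dots> = ?\<sigma> (\<Union>i. B i)" by (simp add: eq)
    finally show "(\<Sum>i. ?\<sigma> (B i)) = ?\<sigma> (\<Union>i. B i)" .
  qed
  moreover have "positive (sets borel) ?\<sigma>" using eq[of "{}"] by (simp add: positive_def)
  ultimately have "emeasure (transport_density \<gamma>) A = ?\<sigma> A"
    unfolding transport_density_def using A by (intro emeasure_measure_of_sigma)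
      (use sets.sigma_algebra_axioms[of "borel :: 'a measure"] in auto)
  then show ?thesis using A by (simp add: eq)
qed

lemma emeasure_transport_density_map_plan:
  fixes T :: "'a::euclidean_space \<Rightarrow> 'a"
  assumes \<gamma>: "\<gamma> \<in> transport_plans \<mu> \<nu>" and \<mu>: "sets \<mu> = sets borel"
    and T[measurable]: "T \<in> borel_measurable borel" and AE: "AE z in \<gamma>. snd z = T (fst z)"
    and A[measurable]: "A \<in> sets borel"
  shows "emeasure (transport_density \<gamma>) A = (\<integral>\<^sup>+ p. emeasure (segment_measure p (T p)) A \<partial>\<mu>)"
proof -
  have \<gamma>s[measurable_cong]: "sets \<gamma> = sets borel" and fst: "distr \<gamma> borel fst = \<mu>"
    using \<gamma> by (auto simp: transport_plans_def)
  have [measurable]: "fst \<in> \<gamma> \<rightarrow>\<^sub>M borel"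
    by (subst measurable_cong_sets[OF \<gamma>s refl]) (intro borel_measurable_continuous_onI continuous_intros)
  have g: "(\<lambda>p. (p, T p)) \<in> borel_measurable borel"
    unfolding borel_prod[symmetric] by measurable
  have m: "(\<lambda>p. emeasure (segment_measure p (T p)) A) \<in> borel_measurable borel"
    using measurable_compose[OF g measurable_emeasure_segment_measure[OF A]] by simp
  have "emeasure (transport_density \<gamma>) A = (\<integral>\<^sup>+ z. emeasure (segment_measure (fst z) (T (fst z))) A \<partial>\<gamma>)"
    unfolding emeasure_transport_density[OF \<gamma>s A]
    using AE by (intro nn_integral_cong_AE) auto
  also have "\<dots> = (\<integral>\<^sup>+ p. emeasure (segment_measure p (T p)) A \<partial>distr \<gamma> borel fst)"
    using m by (subst nn_integral_distr) auto
  finally show ?thesis by (simp add: fst)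
qed

text \<open>
  Complementary slackness. With \<open>\<phi> p = dist p (T p) + u (T p)\<close>, the function
  \<open>dist p q + u q - \<phi> p\<close> is nonnegative and vanishes only on the graph of \<open>T\<close>. The integral of
  \<open>u q - \<phi> p\<close> depends only on the marginals of a plan, so the integral of the whole function is the
  cost minus a constant \<open>K\<close>; it is zero for the plan on the graph. That plan is therefore optimal,
  and any other optimal plan makes the integral zero too, hence lives on the graph.
\<close>

lemma map_plan_unique_optimal:
  fixes T :: "'a::euclidean_space \<Rightarrow> 'a" and u :: "'a \<Rightarrow> real"
  assumes \<mu>: "sets \<mu> = sets borel" "finite_measure \<mu>"
    and T[measurable]: "T \<in> borel_measurable borel" and u[measurable]: "u \<in> borel_measurable borel"
    and D: "AE p in \<mu>. p \<in> D" "bounded D"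
    and E: "E \<in> sets borel" "bounded E" "bounded (u ` E)" "T ` D \<subseteq> E"
    and less: "\<And>p q. p \<in> D \<Longrightarrow> q \<in> E \<Longrightarrow> q \<noteq> T p \<Longrightarrow> dist p (T p) + u (T p) < dist p q + u q"
  shows "distr \<mu> borel (\<lambda>p. (p, T p)) \<in> optimal_plans \<mu> (distr \<mu> borel T)"
    and "\<And>\<gamma>. \<gamma> \<in> optimal_plans \<mu> (distr \<mu> borel T) \<Longrightarrow> AE z in \<gamma>. snd z = T (fst z)"
proof -
  note \<mu>(1)[measurable_cong]
  interpret \<mu>: finite_measure \<mu> by fact
  define \<nu> where "\<nu> = distr \<mu> borel T"
  have [measurable]: "(fst :: 'a \<times> 'a \<Rightarrow> 'a) \<in> borel_measurable borel" "(snd :: 'a \<times> 'a \<Rightarrow> 'a) \<in> borel_measurable borel"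
    by (intro borel_measurable_continuous_onI continuous_intros)+
  have Tpair[measurable]: "(\<lambda>p. (p, T p)) \<in> borel_measurable borel"
    unfolding borel_prod[symmetric] by measurable
  define \<phi> where "\<phi> p = dist p (T p) + u (T p)" for p
  have \<phi>[measurable]: "\<phi> \<in> borel_measurable borel" unfolding \<phi>_def by measurable
  obtain r where r: "\<And>p q. p \<in> D \<Longrightarrow> q \<in> E \<Longrightarrow> dist p q \<le> r"
  proof -
    have "bounded (D \<union> E)" using D E by simp
    then show ?thesis using that diameter_bounded_bound[of "D \<union> E"] by blast
  qed
  obtain c where c: "\<And>q. q \<in> E \<Longrightarrow> \<bar>u q\<bar> \<le> c" using E(3) by (auto simp: bounded_iff)
  define K where "K = (\<integral>p. \<phi> p \<partial>\<mu>) - (\<integral>q. u q \<partial>\<nu>)"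
  have slack: "transport_cost \<gamma> = ennreal (\<integral>z. dist (fst z) (snd z) \<partial>\<gamma>) \<and>
      integrable \<gamma> (\<lambda>z. dist (fst z) (snd z) + u (snd z) - \<phi> (fst z)) \<and>
      (AE z in \<gamma>. 0 \<le> dist (fst z) (snd z) + u (snd z) - \<phi> (fst z)) \<and>
      (AE z in \<gamma>. fst z \<in> D \<and> snd z \<in> E) \<and>
      (\<integral>z. dist (fst z) (snd z) + u (snd z) - \<phi> (fst z) \<partial>\<gamma>) = (\<integral>z. dist (fst z) (snd z) \<partial>\<gamma>) - K"
    if "\<gamma> \<in> transport_plans \<mu> \<nu>" for \<gamma>
  proof -
    have s[measurable_cong]: "sets \<gamma> = sets borel" and d: "distr \<gamma> borel fst = \<mu>" "distr \<gamma> borel snd = \<nu>"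
      using that by (auto simp: transport_plans_def)
    have "emeasure \<gamma> (space \<gamma>) = emeasure \<mu> (space \<mu>)"
      unfolding d(1)[symmetric] by (subst emeasure_distr) auto
    then interpret finite_measure \<gamma> using \<mu>.emeasure_finite by (intro finite_measureI) auto
    have "AE z in \<gamma>. fst z \<in> D" 
      using D(1) unfolding d(1)[symmetric] by (rule AE_distrD[rotated]) measurable
    moreover have "AE z in \<gamma>. snd z \<in> E"
    proof -
      have "AE q in \<nu>. q \<in> E" unfolding \<nu>_def
        using D(1) E(1,4) by (subst AE_distr_iff) auto
      then show ?thesis unfolding d(2)[symmetric] by (rule AE_distrD[rotated]) measurable
    qed
    ultimately have AE: "AE z in \<gamma>. fst z \<in> D \<and> snd z \<in> E" by auto
    have i1: "integrable \<gamma> (\<lambda>z. dist (fst z) (snd z))"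
      by (intro integrable_const_bound[where B = r] eventually_mono[OF AE]) (simp_all add: r)
    have i2: "integrable \<gamma> (\<lambda>z. u (snd z))"
      by (intro integrable_const_bound[where B = c] eventually_mono[OF AE]) (simp_all add: c)
    have b: "\<bar>\<phi> p\<bar> \<le> r + c" if "p \<in> D" for p
      using r[OF that, of "T p"] c[of "T p"] E(4) that unfolding \<phi>_def by (smt (verit) image_subset_iff zero_le_dist)
    have i3: "integrable \<gamma> (\<lambda>z. \<phi> (fst z))"
      by (intro integrable_const_bound[where B = "r + c"] eventually_mono[OF AE]) (simp_all add: b)
    have "transport_cost \<gamma> = (\<integral>\<^sup>+ z. ennreal (dist (fst z) (snd z)) \<partial>\<gamma>)"
      unfolding transport_cost_def by (intro nn_integral_cong) (simp add: dist_norm split: prod.split)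
    also have "\<dots> = ennreal (\<integral>z. dist (fst z) (snd z) \<partial>\<gamma>)"
      by (rule nn_integral_eq_integral[OF i1]) simp
    finally have "transport_cost \<gamma> = ennreal (\<integral>z. dist (fst z) (snd z) \<partial>\<gamma>)" .
    moreover have "integrable \<gamma> (\<lambda>z. dist (fst z) (snd z) + u (snd z) - \<phi> (fst z))"
      using i1 i2 i3 by simp
    moreover have "AE z in \<gamma>. 0 \<le> dist (fst z) (snd z) + u (snd z) - \<phi> (fst z)"
      using AE
    proof (rule eventually_mono)
      fix z assume "fst z \<in> D \<and> snd z \<in> E"
      then show "0 \<le> dist (fst z) (snd z) + u (snd z) - \<phi> (fst z)"
        using less[of "fst z" "snd z"] by (cases "snd z = T (fst z)") (auto simp: \<phi>_def)
    qed
    moreover have "(\<integral>z. dist (fst z) (snd z) + u (snd z) - \<phi> (fst z) \<partial>\<gamma>) = (\<integral>z. dist (fst z) (snd z) \<partial>\<gamma>) - K"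
      using i1 i2 i3 unfolding K_def d[symmetric] by (simp add: integral_distr)
    ultimately show ?thesis using AE by blast
  qed
  define \<gamma>0 where "\<gamma>0 = distr \<mu> borel (\<lambda>p. (p, T p))"
  have \<gamma>0: "\<gamma>0 \<in> transport_plans \<mu> \<nu>"
    by (auto simp: transport_plans_def \<gamma>0_def \<nu>_def distr_distr comp_def distr_id2[OF \<mu>(1)[symmetric]])
  have "(\<integral>z. dist (fst z) (snd z) + u (snd z) - \<phi> (fst z) \<partial>\<gamma>0) = 0"
    unfolding \<gamma>0_def by (subst integral_distr) (auto simp: \<phi>_def)
  then have cost0: "(\<integral>z. dist (fst z) (snd z) \<partial>\<gamma>0) = K" using slack[OF \<gamma>0] by simp
  have costK: "K \<le> (\<integral>z. dist (fst z) (snd z) \<partial>\<gamma>)" if "\<gamma> \<in> transport_plans \<mu> \<nu>" for \<gamma>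
    using slack[OF that] integral_nonneg_AE[of "\<lambda>z. dist (fst z) (snd z) + u (snd z) - \<phi> (fst z)" \<gamma>] by simp
  have "\<gamma>0 \<in> optimal_plans \<mu> \<nu>"
    unfolding optimal_plans_def using \<gamma>0 slack costK cost0 by (auto intro!: ennreal_leI)
  then show "distr \<mu> borel (\<lambda>p. (p, T p)) \<in> optimal_plans \<mu> (distr \<mu> borel T)"
    by (simp add: \<gamma>0_def \<nu>_def)
  fix \<gamma> assume "\<gamma> \<in> optimal_plans \<mu> (distr \<mu> borel T)"
  then have opt: "\<gamma> \<in> transport_plans \<mu> \<nu>" "transport_cost \<gamma> \<le> transport_cost \<gamma>0"
    using \<gamma>0 by (auto simp: optimal_plans_def \<nu>_def)
  have "0 \<le> K" unfolding cost0[symmetric] by simp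
  have "(\<integral>z. dist (fst z) (snd z) \<partial>\<gamma>) \<le> K"
    using opt slack[OF opt(1)] slack[OF \<gamma>0] cost0 \<open>0 \<le> K\<close> by (simp add: ennreal_le_iff)
  then have "(\<integral>z. dist (fst z) (snd z) + u (snd z) - \<phi> (fst z) \<partial>\<gamma>) = 0"
    using slack[OF opt(1)] costK[OF opt(1)] by simp
  then have "AE z in \<gamma>. dist (fst z) (snd z) + u (snd z) - \<phi> (fst z) = 0"
    using slack[OF opt(1)] by (subst (asm) integral_nonneg_eq_0_iff_AE) auto
  moreover have "AE z in \<gamma>. fst z \<in> D \<and> snd z \<in> E" using slack[OF opt(1)] by blast
  ultimately show "AE z in \<gamma>. snd z = T (fst z)"
  proof eventually_elim
    fix z assume "dist (fst z) (snd z) + u (snd z) - \<phi> (fst z) = 0" "fst z \<in> D \<and> snd z \<in> E"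
    then show "snd z = T (fst z)" using less[of "fst z" "snd z"] by (force simp: \<phi>_def)
  qed
qed

section \<open>Bounded densities\<close>

lemma in_Linfty_on_imp_le_lborel:
  fixes \<mu> :: "'a::euclidean_space measure"
  assumes \<mu>: "in_Linfty_on \<mu> \<Omega>" "sets \<mu> = sets borel" and \<Omega>: "\<Omega> \<in> sets borel"
  obtains M :: real where "0 \<le> M"
    "\<And>A. A \<in> sets borel \<Longrightarrow> A \<subseteq> \<Omega> \<Longrightarrow> emeasure \<mu> A \<le> ennreal M * emeasure lborel A"
proof -
  let ?R = "restrict_space lborel \<Omega>"
  obtain \<rho> where \<rho>[measurable]: "\<rho> \<in> borel_measurable ?R"
    and eq: "restrict_space \<mu> \<Omega> = density ?R \<rho>" and fin: "esssup ?R \<rho> < \<infinity>"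
    using \<mu>(1) by (auto simp: in_Linfty_on_def)
  obtain M where M: "0 \<le> M" "esssup ?R \<rho> = ennreal M"
    using fin by (cases "esssup ?R \<rho>") auto
  show ?thesis
  proof (rule that[OF M(1)])
    fix A :: "'a set" assume A: "A \<in> sets borel" "A \<subseteq> \<Omega>"
    then have R: "A \<in> sets ?R" using \<Omega> by (simp add: sets_restrict_space_iff)
    have "emeasure \<mu> A = emeasure (restrict_space \<mu> \<Omega>) A"
      using A \<Omega> \<mu>(2) by (subst emeasure_restrict_space) (auto simp: Int_absorb2 sets_eq_imp_space_eq[OF \<mu>(2)])
    also have "\<dots> = (\<integral>\<^sup>+ x. \<rho> x * indicator A x \<partial>?R)"
      unfolding eq using R by (simp add: emeasure_density)
    also have "\<dots> \<le> (\<integral>\<^sup>+ x. ennreal M * indicator A x \<partial>?R)"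
      using esssup_AE[of \<rho> ?R] unfolding M(2)
      by (intro nn_integral_mono_AE) (auto elim!: eventually_mono intro: mult_right_mono)
    also have "\<dots> = ennreal M * emeasure ?R A" using R by (simp add: nn_integral_cmult_indicator)
    also have "emeasure ?R A = emeasure lborel A"
      using A \<Omega> by (subst emeasure_restrict_space) (auto simp: Int_absorb2)
    finally show "emeasure \<mu> A \<le> ennreal M * emeasure lborel A" .
  qed
qed

lemma in_Linfty_on_density_indicator:
  assumes [measurable]: "D \<in> sets borel" "\<Omega> \<in> sets borel"
  shows "in_Linfty_on (density lborel (indicator D)) \<Omega>"
  unfolding in_Linfty_on_def
proof (intro bexI conjI)
  let ?R = "restrict_space lborel \<Omega>"
  show m[measurable]: "indicator D \<in> borel_measurable ?R"
    by (intro measurable_restrict_space1) measurable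
  show "restrict_space (density lborel (indicator D)) \<Omega> = density ?R (indicator D)"
  proof (rule measure_eqI)
    show "sets (restrict_space (density lborel (indicator D)) \<Omega>) = sets (density ?R (indicator D))"
      by (simp cong: sets_restrict_space_cong)
    fix A assume "A \<in> sets (restrict_space (density lborel (indicator D)) \<Omega>)"
    then have A[measurable]: "A \<in> sets borel" "A \<subseteq> \<Omega>"
      by (auto simp: sets_restrict_space_iff)
    have R: "A \<in> sets ?R" using A by (simp add: sets_restrict_space_iff)
    have "emeasure (restrict_space (density lborel (indicator D)) \<Omega>) A
        = (\<integral>\<^sup>+ x. indicator D x * indicator A x \<partial>lborel)"
      using A by (subst emeasure_restrict_space) (auto simp: Int_absorb2 emeasure_density)
    also have "\<dots> = (\<integral>\<^sup>+ x. (indicator D x * indicator A x) * indicator \<Omega> x \<partial>lborel)"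
      using A by (intro nn_integral_cong) (auto split: split_indicator)
    also have "\<dots> = emeasure (density ?R (indicator D)) A"
      using R by (subst emeasure_density) (auto simp: nn_integral_restrict_space)
    finally show "emeasure (restrict_space (density lborel (indicator D)) \<Omega>) A =
        emeasure (density ?R (indicator D)) A" .
  qed
  have "esssup ?R (indicator D :: _ \<Rightarrow> ennreal) \<le> 1"
    using m by (rule esssup_I) (simp add: indicator_def)
  also have "\<dots> < \<infinity>" by simp
  finally show "esssup ?R (indicator D :: _ \<Rightarrow> ennreal) < \<infinity>" .
qed

section \<open>Lebesgue measure on the plane\<close>

definition point :: "real \<Rightarrow> real \<Rightarrow> real ^ 2" where
  "point x y = x *\<^sub>R axis 1 1 + y *\<^sub>R axis 2 1"

lemma point_nth [simp]: "point x y $ 1 = x" "point x y $ 2 = y"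
  by (simp_all add: point_def axis_def)

lemma dist_real2: "dist p q = sqrt ((p $ 1 - q $ 1)\<^sup>2 + (p $ 2 - q $ 2)\<^sup>2)" for p q :: "real ^ 2"
  by (simp add: dist_vec_def L2_set_def UNIV_2 dist_real_def)

lemma vec_nth_borel_measurable [measurable]: "(\<lambda>p::real ^ 2. p $ i) \<in> borel_measurable borel"
  by (intro borel_measurable_continuous_onI continuous_intros)

lemma point_borel_measurable [measurable]:
  assumes [measurable]: "f \<in> borel_measurable M" "g \<in> borel_measurable M"
  shows "(\<lambda>z. point (f z) (g z)) \<in> borel_measurable M"
  unfolding point_def by measurable

lemma Basis_real2: "(Basis :: (real ^ 2) set) = {axis 1 1, axis 2 1}"
  by (auto simp: Basis_vec_def exhaust_2 UNIV_2)

definition rect :: "real \<Rightarrow> real \<Rightarrow> real \<Rightarrow> real \<Rightarrow> (real ^ 2) set" where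
  "rect a b c d = cbox (point a c) (point b d)"

lemma mem_rect: "p \<in> rect a b c d \<longleftrightarrow> a \<le> p $ 1 \<and> p $ 1 \<le> b \<and> c \<le> p $ 2 \<and> p $ 2 \<le> d"
  by (auto simp: rect_def mem_box_cart forall_2)

lemma rect_borel [measurable]: "rect a b c d \<in> sets borel"
  by (simp add: rect_def)

lemma emeasure_lborel_rect:
  assumes "a \<le> b" "c \<le> d"
  shows "emeasure lborel (rect a b c d) = ennreal ((b - a) * (d - c))"
  unfolding rect_def using assms
  by (subst emeasure_lborel_cbox) (auto simp: Basis_real2 inner_axis axis_eq_axis)

text \<open>
  Lebesgue measure on \<open>real ^ 2\<close> is not a product measure by construction; this identification
  gives access to Fubini.
\<close>

lemma lborel_real2: "(lborel :: (real ^ 2) measure) =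
    distr (lborel \<Otimes>\<^sub>M lborel) borel (\<lambda>z. point (fst z) (snd z))"
proof (rule lborel_eqI)
  fix l u :: "real ^ 2"
  assume "\<And>b. b \<in> Basis \<Longrightarrow> l \<bullet> b \<le> u \<bullet> b"
  then have le: "l $ 1 \<le> u $ 1" "l $ 2 \<le> u $ 2"
    using inner_axis[of l _ 1] inner_axis[of u _ 1] by (force simp: Basis_real2)+
  have "(\<lambda>z. point (fst z) (snd z)) -` box l u = {l $ 1<..<u $ 1} \<times> {l $ 2<..<u $ 2}"
    by (auto simp: mem_box_cart forall_2)
  then have "emeasure (distr (lborel \<Otimes>\<^sub>M lborel) borel (\<lambda>z. point (fst z) (snd z))) (box l u) =
      emeasure lborel {l $ 1<..<u $ 1} * emeasure lborel {l $ 2<..<u $ 2}"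
    by (subst emeasure_distr) (auto simp: space_pair_measure lborel.emeasure_pair_measure_Times)
  also have "\<dots> = (\<Prod>b\<in>Basis. (u - l) \<bullet> b)"
    using le by (simp add: Basis_real2 inner_axis axis_eq_axis ennreal_mult)
  finally show "emeasure (distr (lborel \<Otimes>\<^sub>M lborel) borel (\<lambda>z. point (fst z) (snd z))) (box l u) =
      (\<Prod>b\<in>Basis. (u - l) \<bullet> b)" .
qed simp

lemma emeasure_lborel_real2:
  assumes [measurable]: "A \<in> sets borel"
  shows "emeasure lborel A = (\<integral>\<^sup>+ x. emeasure lborel {y. point x y \<in> A} \<partial>lborel)"
proof -
  let ?P = "(\<lambda>z. point (fst z) (snd z)) -` A \<inter> space (lborel \<Otimes>\<^sub>M lborel)"
  have P: "?P \<in> sets (lborel \<Otimes>\<^sub>M lborel)" by measurable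
  have "emeasure lborel A = emeasure (lborel \<Otimes>\<^sub>M lborel) ?P"
    by (subst lborel_real2, subst emeasure_distr) auto
  also have "\<dots> = (\<integral>\<^sup>+ x. emeasure lborel (Pair x -` ?P) \<partial>lborel)"
    using P by (rule lborel.emeasure_pair_measure_alt)
  also have "(\<lambda>x. Pair x -` ?P) = (\<lambda>x. {y. point x y \<in> A})" by (auto simp: space_pair_measure)
  finally show ?thesis .
qed

section \<open>The transport rays\<close>

text \<open>
  The abscissa \<open>s\<close> at which the ray \<open>y = - s (x - s)\<close> through the point \<open>p\<close> meets the horizontal axis:
  the smaller root of \<open>s\<^sup>2 - x s - y = 0\<close>.
\<close>

definition foot :: "real ^ 2 \<Rightarrow> real" where
  "foot p = (p $ 1 - sqrt ((p $ 1)\<^sup>2 + 4 * p $ 2)) / 2"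

definition landing :: "real ^ 2 \<Rightarrow> real ^ 2" where
  "landing p = point (foot p) 0"

lemma foot_borel_measurable [measurable]: "foot \<in> borel_measurable borel"
  unfolding foot_def by measurable

lemma landing_borel_measurable [measurable]: "landing \<in> borel_measurable borel"
  unfolding landing_def by measurable

lemma foot_quadratic:
  assumes "0 \<le> p $ 2"
  shows "p $ 2 = - foot p * (p $ 1 - foot p)"
proof -
  have "(sqrt ((p $ 1)\<^sup>2 + 4 * p $ 2))\<^sup>2 = (p $ 1)\<^sup>2 + 4 * p $ 2"
    using assms by simp
  then show ?thesis unfolding foot_def by (simp add: field_simps power2_eq_square)
qed

lemma foot_le_0: "0 \<le> p $ 2 \<Longrightarrow> foot p \<le> 0"
  unfolding foot_def by (simp add: real_le_rsqrt)

lemma foot_ge: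
  assumes "1 \<le> p $ 1" "p $ 2 \<le> e" "0 \<le> e"
  shows "- e \<le> foot p"
proof -
  have "p $ 2 \<le> e * p $ 1" using assms mult_left_mono[of 1 "p $ 1" e] by simp
  then have "4 * p $ 2 \<le> 4 * (e * p $ 1) + 4 * e\<^sup>2"
    using zero_le_power2[of e] by linarith
  then have "(p $ 1)\<^sup>2 + 4 * p $ 2 \<le> (p $ 1 + 2 * e)\<^sup>2"
    by (simp add: power2_eq_square algebra_simps)
  then have "sqrt ((p $ 1)\<^sup>2 + 4 * p $ 2) \<le> p $ 1 + 2 * e"
    using assms by (intro real_le_lsqrt) auto
  then show ?thesis by (simp add: foot_def)
qed

text \<open>
  The derivative of \<open>sqrt ((x - t)\<^sup>2 + y\<^sup>2) + arsinh t\<close> is the cosine of the inclination of the ray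
  with parameter \<open>t\<close> minus that of the inclination of the segment from \<open>(t, 0)\<close> to \<open>(x, y)\<close>. Comparing
  cosines amounts to comparing \<open>- t (x - t)\<close>, the height of the ray above \<open>x\<close>, with \<open>y\<close>. As the
  height decreases in \<open>t\<close>, the derivative changes sign exactly once, at the parameter \<open>a\<close> of the ray
  through \<open>(x, y)\<close>.
\<close>

lemma potential_less:
  fixes x y a s :: real
  assumes x: "0 < x" and a: "a \<le> 0" and s: "s \<le> 0" "s \<noteq> a" and y: "y = - a * (x - a)"
  shows "sqrt ((x - a)\<^sup>2 + y\<^sup>2) + arsinh a < sqrt ((x - s)\<^sup>2 + y\<^sup>2) + arsinh s"
proof -
  define F where "F t = sqrt ((x - t)\<^sup>2 + y\<^sup>2) + arsinh t" for t
  define F' where "F' t = 1 / sqrt (t\<^sup>2 + 1) - (x - t) / sqrt ((x - t)\<^sup>2 + y\<^sup>2)" for t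
  have pos: "0 < (x - t)\<^sup>2 + y\<^sup>2" if "t \<le> 0" for t
    using x that by (simp add: add_pos_nonneg)
  have deriv: "(F has_real_derivative F' t) (at t)" if "t \<le> 0" for t
    unfolding F_def F'_def using pos[OF that]
    by (auto intro!: derivative_eq_intros simp: divide_simps) (simp_all add: algebra_simps)
  have y0: "0 \<le> y" using x a unfolding y by (simp add: mult_nonpos_nonneg)
  have sqrt1: "sqrt ((x - t)\<^sup>2 * (t\<^sup>2 + 1)) = (x - t) * sqrt (t\<^sup>2 + 1)" if "t \<le> 0" for t
    using x that by (simp add: real_sqrt_mult)
  have expand: "(x - t)\<^sup>2 * (t\<^sup>2 + 1) = (x - t)\<^sup>2 + (- t * (x - t))\<^sup>2" for t
    by (simp add: power2_eq_square algebra_simps)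
  have neg: "F' t < 0" if "t < a" for t
  proof -
    have t: "t \<le> 0" using that a by simp
    have "- a * (x - a) < - t * (x - t)"
      using that x a by (intro mult_strict_mono) auto
    then have "y\<^sup>2 < (- t * (x - t))\<^sup>2" using y0 unfolding y by (intro power_strict_mono) auto
    then have "sqrt ((x - t)\<^sup>2 + y\<^sup>2) < (x - t) * sqrt (t\<^sup>2 + 1)"
      unfolding sqrt1[OF t, symmetric] expand by simp
    moreover have "0 < sqrt (t\<^sup>2 + 1)" by (simp add: add_nonneg_pos)
    ultimately show ?thesis using pos[OF t] x t unfolding F'_def by (auto simp: divide_simps mult.commute)
  qed
  have posd: "0 < F' t" if "a < t" "t \<le> 0" for t
  proof -
    have "- t * (x - t) < - a * (x - a)"
      using that x a by (intro mult_strict_mono) auto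
    then have "(- t * (x - t))\<^sup>2 < y\<^sup>2" 
      using that x unfolding y by (intro power_strict_mono) (auto intro: mult_nonneg_nonneg simp: mult_nonpos_nonneg)
    then have "(x - t) * sqrt (t\<^sup>2 + 1) < sqrt ((x - t)\<^sup>2 + y\<^sup>2)"
      unfolding sqrt1[OF that(2), symmetric] expand by simp
    moreover have "0 < sqrt (t\<^sup>2 + 1)" by (simp add: add_nonneg_pos)
    ultimately show ?thesis using pos[OF that(2)] x that unfolding F'_def by (auto simp: divide_simps mult.commute)
  qed
  have cont: "continuous_on {u..v} F" if "v \<le> 0" for u v
    using that by (intro DERIV_continuous_on[where D = F'] DERIV_subset[OF deriv]) auto
  have "F a < F s"
  proof (cases "s < a")
    case True
    show ?thesis
    proof (rule DERIV_neg_imp_decreasing_open[OF True])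
      fix t assume "s < t" "t < a"
      then show "\<exists>d. (F has_real_derivative d) (at t) \<and> d < 0"
        using deriv[of t] neg[of t] a by auto
    qed (rule cont[OF a])
  next
    case False
    then have "a < s" using s by simp
    then show ?thesis
    proof (rule DERIV_pos_imp_increasing_open)
      fix t assume "a < t" "t < s"
      then show "\<exists>d. (F has_real_derivative d) (at t) \<and> 0 < d"
        using deriv[of t] posd[of t] s by auto
    qed (rule cont[OF s(1)])
  qed
  then show ?thesis by (simp add: F_def)
qed

section \<open>The example\<close>

text \<open>
  On each vertical line the ordinate \<open>- a (x - a)\<close> is 4-Lipschitz in the landing abscissa \<open>a\<close>, so the
  points that land in a set of diameter \<open>d\<close> fill at most the length \<open>4 d\<close> of the line.
\<close>

lemma landing_measure_le_hausdorff1: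
  fixes A :: "(real ^ 2) set"
  assumes A: "A \<in> sets borel"
  shows "emeasure (distr (density lborel (indicator (rect 1 2 0 1))) borel landing) A \<le> ennreal 4 * hausdorff1 A"
    (is "emeasure ?\<nu> A \<le> _")
proof -
  have le: "ennreal (1 / 4) * emeasure ?\<nu> B \<le> ennreal (diameter B)" if B: "closed B" "bounded B" for B
  proof -
    have [measurable]: "B \<in> sets borel" using B by simp
    let ?S = "{p \<in> rect 1 2 0 1. landing p \<in> B}"
    have S[measurable]: "?S \<in> sets borel" by measurable
    have d: "0 \<le> diameter B" using B(2) by (rule diameter_ge_0)
    have slice: "emeasure lborel {y. point x y \<in> ?S} \<le> ennreal (4 * diameter B) * indicator {1..2} x" for x
    proof (cases "x \<in> {1..2}")
      case True
      have "emeasure lborel {y. point x y \<in> ?S} \<le> ennreal (4 * diameter B)"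
      proof (rule emeasure_lborel_le_diameter)
        fix y y' assume "y \<in> {y. point x y \<in> ?S}" "y' \<in> {y. point x y \<in> ?S}"
        then have y: "0 \<le> y" "y \<le> 1" "0 \<le> y'" "y' \<le> 1"
          and land: "landing (point x y) \<in> B" "landing (point x y') \<in> B"
          by (auto simp: mem_rect)
        define a a' where "a = foot (point x y)" and "a' = foot (point x y')"
        have "\<bar>a - a'\<bar> \<le> diameter B"
          using diameter_bounded_bound[OF B(2) land] by (simp add: landing_def dist_real2 a_def a'_def)
        moreover have "y = - a * (x - a)" "y' = - a' * (x - a')"
          using foot_quadratic[of "point x y"] foot_quadratic[of "point x y'"] y by (auto simp: a_def a'_def)
        then have "y - y' = (a - a') * (a + a' - x)" by (simp add: algebra_simps)
        then have "\<bar>y - y'\<bar> = \<bar>a - a'\<bar> * \<bar>a + a' - x\<bar>" by (simp add: abs_mult)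
        moreover have "- 1 \<le> a" "a \<le> 0" "- 1 \<le> a'" "a' \<le> 0"
          using foot_ge[of "point x y" 1] foot_ge[of "point x y'" 1] foot_le_0[of "point x y"]
            foot_le_0[of "point x y'"] y True by (auto simp: a_def a'_def)
        then have "\<bar>a + a' - x\<bar> \<le> 4" using True by auto
        ultimately show "\<bar>y - y'\<bar> \<le> 4 * diameter B"
          using mult_mono[of "\<bar>a - a'\<bar>" "diameter B" "\<bar>a + a' - x\<bar>" 4] d by simp
      qed (use d in simp)
      then show ?thesis using True by simp
    next
      case False
      then have "{y. point x y \<in> ?S} = {}" by (auto simp: mem_rect)
      then show ?thesis by (simp only: emeasure_empty zero_le)
    qed
    have "emeasure ?\<nu> B = emeasure (density lborel (indicator (rect 1 2 0 1))) (landing -` B)"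
      by (subst emeasure_distr) auto
    also have "\<dots> = (\<integral>\<^sup>+ p. indicator (rect 1 2 0 1) p * indicator (landing -` B) p \<partial>lborel)"
      by (subst emeasure_density) (auto intro: measurable_sets_borel[OF landing_borel_measurable])
    also have "\<dots> = (\<integral>\<^sup>+ p. indicator ?S p \<partial>lborel)"
      by (intro nn_integral_cong) (auto split: split_indicator)
    also have "\<dots> = emeasure lborel ?S" using S by simp
    also have "\<dots> = (\<integral>\<^sup>+ x. emeasure lborel {y. point x y \<in> ?S} \<partial>lborel)"
      using S by (rule emeasure_lborel_real2)
    also have "\<dots> \<le> (\<integral>\<^sup>+ x. ennreal (4 * diameter B) * indicator {1..2} (x::real) \<partial>lborel)"
      using slice by (intro nn_integral_mono) auto
    also have "\<dots> = ennreal (4 * diameter B)" by (simp add: nn_integral_cmult_indicator)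
    finally have "ennreal (1 / 4) * emeasure ?\<nu> B \<le> ennreal (1 / 4) * ennreal (4 * diameter B)"
      by (rule mult_left_mono) simp
    also have "\<dots> = ennreal (diameter B)" using d by (simp add: ennreal_mult[symmetric])
    finally show ?thesis .
  qed
  have "ennreal 4 * ennreal (1 / 4) = ennreal (4 * (1 / 4))"
    by (rule ennreal_mult[symmetric]) simp_all
  then have "emeasure ?\<nu> A = ennreal 4 * (ennreal (1 / 4) * emeasure ?\<nu> A)"
    by (simp add: mult.assoc[symmetric])
  also have "\<dots> \<le> ennreal 4 * hausdorff1 A"
    by (intro mult_left_mono mass_distribution_principle le) auto
  finally show ?thesis .
qed

text \<open>
  A ray that starts at height at most \<open>e\<close> lands at some \<open>a\<close> in \<open>[-e, 0]\<close>. Over \<open>0 \<le> x \<le> e\<close> its height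
  \<open>- a (x - a)\<close> is at most \<open>e (2 e)\<close>, so the whole part over that interval, of length at least \<open>e\<close>,
  stays in the rectangle.
\<close>

lemma segment_measure_landing_ge:
  assumes e: "0 \<le> e" "e \<le> 1" and p: "p \<in> rect 1 2 0 e"
  shows "ennreal e \<le> emeasure (segment_measure p (landing p)) (rect 0 e 0 (2 * e\<^sup>2))"
proof -
  define a where "a = foot p"
  have p': "1 \<le> p $ 1" "0 \<le> p $ 2" "p $ 2 \<le> e" using p by (auto simp: mem_rect)
  have a: "a \<le> 0" "- e \<le> a" and quad: "p $ 2 = - a * (p $ 1 - a)"
    using p' e foot_le_0 foot_ge foot_quadratic by (auto simp: a_def)
  define w where "w = p $ 1 - a"
  have w: "p $ 1 \<le> w" "0 < w" using a p' by (auto simp: w_def)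
  have dist: "w \<le> dist p (landing p)"
    using w by (simp add: dist_real2 landing_def a_def[symmetric] w_def[symmetric] real_le_rsqrt)
  \<comment> \<open>at parameter \<open>t\<close> the abscissa is \<open>p $ 1 - t * w\<close>, which runs through \<open>[0, e]\<close> for these \<open>t\<close>\<close>
  have "{(p $ 1 - e) / w .. p $ 1 / w} \<subseteq> {t \<in> {0..1}. linepath p (landing p) t \<in> rect 0 e 0 (2 * e\<^sup>2)}"
  proof
    fix t assume "t \<in> {(p $ 1 - e) / w .. p $ 1 / w}"
    then have tw: "p $ 1 - e \<le> t * w" "t * w \<le> p $ 1" using w by (auto simp: field_simps)
    have t: "0 \<le> t" "t \<le> 1"
    proof -
      have "0 \<le> t * w" using tw p' e by simp
      then show "0 \<le> t" using w by (simp add: zero_le_mult_iff)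
      have "t * w \<le> 1 * w" using tw w by linarith
      then show "t \<le> 1" using w(2) by (rule mult_right_le_imp_le)
    qed
    have c1: "linepath p (landing p) t $ 1 = p $ 1 - t * w"
      by (simp add: linepath_def landing_def a_def[symmetric] w_def algebra_simps)
    have "linepath p (landing p) t $ 2 = (1 - t) * p $ 2"
      by (simp add: linepath_def landing_def)
    also have "\<dots> = - a * (p $ 1 - t * w - a)" unfolding quad by (simp add: w_def algebra_simps)
    also have "\<dots> \<le> e * (2 * e)" using a e tw by (intro mult_mono) auto
    finally have "linepath p (landing p) t $ 2 \<le> 2 * e\<^sup>2" by (simp add: power2_eq_square)
    moreover have "0 \<le> linepath p (landing p) t $ 2" using t p' by (simp add: linepath_def landing_def)
    ultimately show "t \<in> {t \<in> {0..1}. linepath p (landing p) t \<in> rect 0 e 0 (2 * e\<^sup>2)}"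
      using t tw c1 by (simp add: mem_rect)
  qed
  then have "emeasure lborel {(p $ 1 - e) / w .. p $ 1 / w} \<le>
      emeasure lborel {t \<in> {0..1}. linepath p (landing p) t \<in> rect 0 e 0 (2 * e\<^sup>2)}"
    by (rule emeasure_mono) measurable
  moreover have "emeasure lborel {(p $ 1 - e) / w .. p $ 1 / w} = ennreal (e / w)"
    using w e by (subst emeasure_lborel_Icc) (auto simp: field_simps)
  ultimately have "ennreal w * ennreal (e / w) \<le> ennreal (dist p (landing p)) *
      emeasure lborel {t \<in> {0..1}. linepath p (landing p) t \<in> rect 0 e 0 (2 * e\<^sup>2)}"
    using dist by (intro mult_mono) (auto intro: ennreal_leI)
  then show ?thesis
    using w e by (simp add: emeasure_segment_measure ennreal_mult[symmetric])
qed

theorem mainTheorem2: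
  shows "\<exists>(\<Omega> :: (real ^ 2) set) (f\<^sub>p :: (real ^ 2) measure) (f\<^sub>m :: (real ^ 2) measure).
    compact \<Omega> \<and> convex \<Omega> \<and> interior \<Omega> \<noteq> {} \<and>
    sets f\<^sub>p = sets borel \<and> finite_measure f\<^sub>p \<and>
    emeasure f\<^sub>p (- \<Omega>) = 0 \<and> in_Linfty_on f\<^sub>p \<Omega> \<and>
    sets f\<^sub>m = sets borel \<and> emeasure f\<^sub>m UNIV = emeasure f\<^sub>p UNIV \<and>
    emeasure f\<^sub>m (- frontier \<Omega>) = 0 \<and>
    (\<exists>C :: real. \<forall>A \<in> sets borel. emeasure f\<^sub>m A \<le> ennreal C * hausdorff1 (A \<inter> frontier \<Omega>)) \<and>
    optimal_plans f\<^sub>p f\<^sub>m \<noteq> {} \<and>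
    (\<forall>\<gamma> \<in> optimal_plans f\<^sub>p f\<^sub>m. \<not> in_Linfty_on (transport_density \<gamma>) \<Omega>)"
proof -
  define \<Omega> where "\<Omega> = rect (- 1) 2 0 1"
  define D where "D = rect 1 2 0 1"
  define \<mu> where "\<mu> = density lborel (indicator D)"
  define \<nu> where "\<nu> = distr \<mu> borel landing"
  have [measurable]: "D \<in> sets borel" "\<Omega> \<in> sets borel" by (simp_all add: D_def \<Omega>_def)
  have sets[measurable_cong]: "sets \<mu> = sets borel" by (simp add: \<mu>_def)
  have mu: "emeasure \<mu> A = emeasure lborel (D \<inter> A)" if [measurable]: "A \<in> sets borel" for A
    unfolding \<mu>_def by (simp add: emeasure_density indicator_inter_arith[symmetric])
  have AE_D: "AE p in \<mu>. p \<in> D" unfolding \<mu>_def by (subst AE_density) (auto simp: indicator_def)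
  have fin: "finite_measure \<mu>"
    by (intro finite_measureI) (simp add: mu sets_eq_imp_space_eq[OF sets] D_def emeasure_lborel_rect)
  have D_sub: "D \<subseteq> \<Omega>" by (auto simp: D_def \<Omega>_def mem_rect)
  have int: "interior \<Omega> = box (point (- 1) 0) (point 2 1)"
    by (simp add: \<Omega>_def rect_def)
  have "point 0 (1 / 2) \<in> interior \<Omega>" unfolding int by (simp add: mem_box_cart forall_2)
  then have int_ne: "interior \<Omega> \<noteq> {}" by blast
  have compact: "compact \<Omega>" and convex: "convex \<Omega>" by (simp_all add: \<Omega>_def rect_def)
  have foot_D: "- 1 \<le> foot p" "foot p \<le> 0" if "p \<in> D" for p
    using that foot_ge[of p 1] foot_le_0[of p] by (auto simp: D_def mem_rect)
  have front: "landing p \<in> frontier \<Omega>" if "p \<in> D" for p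
    using foot_D[OF that] compact
    by (auto simp: frontier_def closure_closed compact_imp_closed int landing_def mem_box_cart forall_2)
       (auto simp: \<Omega>_def mem_rect)
  have nu_front: "AE q in \<nu>. q \<in> frontier \<Omega>"
    unfolding \<nu>_def using AE_D front by (subst AE_distr_iff) auto
  \<comment> \<open>the bottom side, up to the origin: the rays land there\<close>
  define E where "E = rect (- 1) 0 0 0"
  have bE: "bounded E" and bD: "bounded D" by (simp_all add: E_def D_def rect_def)
  have E_sets: "E \<in> sets borel" by (simp add: E_def)
  have cont: "continuous_on S (\<lambda>q :: real ^ 2. arsinh (q $ 1))" for S
    by (rule continuous_on_compose2[OF continuous_on_arsinh[of UNIV]]) (auto intro: continuous_intros)
  then have u: "(\<lambda>q :: real ^ 2. arsinh (q $ 1)) \<in> borel_measurable borel"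
    by (rule borel_measurable_continuous_onI)
  have bu: "bounded ((\<lambda>q. arsinh (q $ 1)) ` E)"
    by (intro compact_imp_bounded compact_continuous_image cont) (simp add: E_def rect_def)
  have land_E: "landing ` D \<subseteq> E" using foot_D by (auto simp: E_def mem_rect landing_def)
  have less: "dist p (landing p) + arsinh (landing p $ 1) < dist p q + arsinh (q $ 1)"
    if p: "p \<in> D" and q: "q \<in> E" and ne: "q \<noteq> landing p" for p q
  proof -
    have q': "q $ 1 \<le> 0" "q $ 2 = 0" using q by (auto simp: E_def mem_rect)
    have "q $ 1 \<noteq> foot p" using ne q' by (auto simp: landing_def vec_eq_iff forall_2)
    moreover have "0 < p $ 1" "p $ 2 = - foot p * (p $ 1 - foot p)"
      using p foot_quadratic[of p] by (auto simp: D_def mem_rect)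
    ultimately show ?thesis
      using potential_less[of "p $ 1" "foot p" "q $ 1" "p $ 2"] foot_D[OF p] q'
      by (simp add: dist_real2 landing_def)
  qed
  note opt = map_plan_unique_optimal[OF sets fin landing_borel_measurable u AE_D bD E_sets bE bu land_E less,
      folded \<nu>_def]
  have unbounded: "\<not> in_Linfty_on (transport_density \<gamma>) \<Omega>" if \<gamma>: "\<gamma> \<in> optimal_plans \<mu> \<nu>" for \<gamma>
  proof
    assume bd: "in_Linfty_on (transport_density \<gamma>) \<Omega>"
    have plan: "\<gamma> \<in> transport_plans \<mu> \<nu>" using \<gamma> by (simp add: optimal_plans_def)
    have sets_td: "sets (transport_density \<gamma>) = sets borel"
      using sets.sigma_sets_eq[of "borel :: (real ^ 2) measure"] by (simp add: transport_density_def)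
    obtain M where M: "0 \<le> M" and
      le: "\<And>A. A \<in> sets borel \<Longrightarrow> A \<subseteq> \<Omega> \<Longrightarrow> emeasure (transport_density \<gamma>) A \<le> ennreal M * emeasure lborel A"
      using in_Linfty_on_imp_le_lborel[OF bd sets_td] by auto
    \<comment> \<open>small enough for \<open>e\<^sup>2 > M * (2 * e\<^sup>3)\<close>, and at most \<open>1 / 2\<close> so that the flat rectangle lies in \<open>\<Omega>\<close>\<close>
    define e where "e = 1 / (2 * M + 2)"
    have e: "0 < e" "e \<le> 1 / 2" "2 * M * e < 1" using M by (auto simp: e_def field_simps)
    have e2: "2 * e\<^sup>2 \<le> 1" using e mult_mono[of e "1/2" e "1/2"] by (simp add: power2_eq_square)
    define A where "A = rect 0 e 0 (2 * e\<^sup>2)"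
    have A: "A \<in> sets borel" "A \<subseteq> \<Omega>" using e e2 by (auto simp: A_def \<Omega>_def mem_rect)
    have strip: "rect 1 2 0 e \<subseteq> D" using e by (auto simp: D_def mem_rect)
    have "ennreal (e * e) = ennreal e * emeasure \<mu> (rect 1 2 0 e)"
      using e strip by (simp add: mu Int_absorb1 emeasure_lborel_rect ennreal_mult)
    also have "\<dots> = (\<integral>\<^sup>+ p. ennreal e * indicator (rect 1 2 0 e) p \<partial>\<mu>)"
      by (subst nn_integral_cmult_indicator) (auto simp: sets)
    also have "\<dots> \<le> (\<integral>\<^sup>+ p. emeasure (segment_measure p (landing p)) A \<partial>\<mu>)"
      using segment_measure_landing_ge[of e] e
      by (intro nn_integral_mono) (auto simp: A_def split: split_indicator)
    also have "\<dots> = emeasure (transport_density \<gamma>) A"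
      using emeasure_transport_density_map_plan[OF plan sets landing_borel_measurable opt(2)[OF _ _ _ \<gamma>] A(1)] by simp
    also have "\<dots> \<le> ennreal M * emeasure lborel A" by (rule le[OF A])
    also have "\<dots> = ennreal (M * (e * (2 * e\<^sup>2)))"
      using e M by (simp add: A_def emeasure_lborel_rect ennreal_mult)
    finally have "e * e \<le> M * (e * (2 * e\<^sup>2))"
      using e M by (simp add: ennreal_le_iff)
    also have "\<dots> = (2 * M * e) * (e * e)" by (simp add: power2_eq_square)
    also have "\<dots> < 1 * (e * e)" using e by (intro mult_strict_right_mono) auto
    finally show False by simp
  qed
  show ?thesis
  proof (intro exI conjI ballI)
    show "emeasure \<mu> (- \<Omega>) = 0"
    proof -
      have "D \<inter> - \<Omega> = {}" using D_sub by blast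
      then show ?thesis by (simp add: mu)
    qed
    show "in_Linfty_on \<mu> \<Omega>" unfolding \<mu>_def by (rule in_Linfty_on_density_indicator) simp_all
    show "emeasure \<nu> UNIV = emeasure \<mu> UNIV"
      unfolding \<nu>_def by (subst emeasure_distr) (auto simp: sets_eq_imp_space_eq[OF sets])
    show "emeasure \<nu> (- frontier \<Omega>) = 0"
      using nu_front by (subst (asm) AE_iff_measurable[of "- frontier \<Omega>"]) (auto simp: \<nu>_def)
    show "emeasure \<nu> A \<le> ennreal 4 * hausdorff1 (A \<inter> frontier \<Omega>)" if A: "A \<in> sets borel" for A
    proof -
      have "emeasure \<nu> A = emeasure \<nu> (A \<inter> frontier \<Omega>)"
        using nu_front A by (intro emeasure_eq_AE) (auto simp: \<nu>_def)
      also have "\<dots> \<le> ennreal 4 * hausdorff1 (A \<inter> frontier \<Omega>)"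
        using A unfolding \<nu>_def \<mu>_def D_def by (intro landing_measure_le_hausdorff1) auto
      finally show ?thesis .
    qed
    show "optimal_plans \<mu> \<nu> \<noteq> {}" using opt(1) by blast
  qed (use compact convex int_ne sets fin unbounded in \<open>simp_all add: \<nu>_def\<close>)
qed

end
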